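(* For every integer $n\geq 2$, $$L_n = A_n = n!\,Q_n,$$ where $L_n$ is the number of preference lists $\alpha\in[n]^n$ with exactly $n-1$ lucky cars, $Q_n=2(n+1)H_n-4n$ (with $H_n=\sum_{i=1}^n \frac1i$) is the expected number of pivot comparisons made by Quicksort on a uniformly random ordering of an array of size $n$, and $A_n$ is the total number of pivot comparisons made by Quicksort over all $n!$ orderings of an array of size $n$; that is, $L_n=n!\,[2(n+1)H_n-4n]$.
   Context: Parking: For $n\in\mathbb{N}$ let $[n]=\{1,\dots,n\}$. A preference list of length $n$ is a tuple $\alpha=(p_1,\dots,p_n)\in[n]^n$. Cars $1,2,\dots,n$ enter, in this order, a one-way street with parking spots $1,\dots,n$. Car $i$ parks in the first unoccupied spot numbered greater than or equal to $p_i$, if such a spot exists; otherwise car $i$ is unable to park (and the remaining cars continue in order). Car $i$ is lucky if it parks in its preferred spot $p_i$; a car that is unable to park is not lucky. $\mathrm{Lucky}(\alpha)$ is the number of lucky cars of $\alpha$. It is not required that all cars be able to park. Set $L_n=|\{\alpha\in[n]^n:\mathrm{Lucky}(\alpha)=n-1\}|$. Quicksort: Given an array of $n\ge 1$ elements, Quicksort selects a pivot element, makes $n-1$ pivot comparisons to split the other elements into a left array (elements less than or equal to the pivot) and a right array (elements greater than the pivot), and then recurses separately on the left and right arrays. The expected number $Q_n$ of pivot comparisons (including all recursive calls) on an array of size $n$ ordered uniformly at random is determined by $Q_0=0$ and, for $n\geq 1$, $Q_n=(n-1)+\frac1n\sum_{k=1}^n (Q_{k-1}+Q_{n-k})$ (the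 pivot being equally likely to be the $k$th smallest element for each $k$); it is given in closed form by $Q_n=2(n+1)H_n-4n$, where $H_n=\sum_{i=1}^n\frac1i$. The total number of comparisons over all $n!$ orderings is $A_n=n!\,Q_n$. *)

theory Defs
  imports "HOL-Probability.Probability" "HOL-Combinatorics.Multiset_Permutations"
begin

definition preference_lists :: "nat \<Rightarrow> nat list set" where
  "preference_lists n = {\<alpha>. length \<alpha> = n \<and> set \<alpha> \<subseteq> {1..n}}"

text \<open>The spot taken by a car with preference \<open>p\<close> when the spots in \<open>occ\<close> are already taken;
  \<open>None\<close> if the car is unable to park.\<close>

definition park_spot :: "nat \<Rightarrow> nat set \<Rightarrow> nat \<Rightarrow> nat option" where
  "park_spot n occ p =
     (if {p..n} - occ = {} then None else Some (Min ({p..n} - occ)))"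

primrec park_from :: "nat \<Rightarrow> nat set \<Rightarrow> nat list \<Rightarrow> nat option list" where
  "park_from n occ [] = []"
| "park_from n occ (p # ps) =
     park_spot n occ p # park_from n (occ \<union> set_option (park_spot n occ p)) ps"

definition parking_outcome :: "nat list \<Rightarrow> nat option list" where
  "parking_outcome \<alpha> = park_from (length \<alpha>) {} \<alpha>"

text \<open>List indices start at 0, so index \<open>i\<close> belongs to car \<open>i + 1\<close>.\<close>

definition lucky :: "nat list \<Rightarrow> nat" where
  "lucky \<alpha> = card {i. i < length \<alpha> \<and> parking_outcome \<alpha> ! i = Some (\<alpha> ! i)}"

definition lucky_lists_count :: "nat \<Rightarrow> nat" where
  "lucky_lists_count n = card {\<alpha> \<in> preference_lists n. lucky \<alpha> = n - 1}"

text \<open>Number of pivot comparisons made by Quicksort, counting one comparison of the pivot with each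
  of the other elements. The pivot is the first element, and the other elements keep their
  relative order in the left and right arrays. On a uniformly random ordering the pivot is thus
  equally likely to be the \<open>k\<close>th smallest element for each \<open>k\<close>, also in the recursive calls.\<close>

fun quicksort_comparisons :: "'a::linorder list \<Rightarrow> nat" where
  "quicksort_comparisons [] = 0"
| "quicksort_comparisons (x # xs) =
     length xs + quicksort_comparisons (filter (\<lambda>y. y \<le> x) xs)
               + quicksort_comparisons (filter (\<lambda>y. y > x) xs)"

definition total_comparisons :: "nat \<Rightarrow> nat" where
  "total_comparisons n = (\<Sum>xs\<in>permutations_of_set {1..n}. quicksort_comparisons xs)"

definition expected_comparisons :: "nat \<Rightarrow> real" where
  "expected_comparisons n = measure_pmf.expectation (pmf_of_set (permutations_of_set {1..n}))
           (\<lambda>xs. real (quicksort_comparisons xs))"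

end

theory Submission
  imports Defs
begin

text \<open>
  Let \<open>D f\<close> be the number of pairs of a set \<open>F\<close> of \<open>f\<close> free spots and a list of \<open>f\<close> preferences
  with exactly one unlucky car, when the spots outside \<open>F\<close> are taken initially. A lucky first car
  moves us from \<open>F\<close> to \<open>F - {p}\<close>, and each \<open>(f - 1)\<close>-subset arises in \<open>n - f + 1\<close> ways; averaging
  over all \<open>F\<close> also removes the dependence on the shape of \<open>F\<close> when the first car is unlucky. The
  resulting recurrence telescopes to \<open>D f * (n - f)! / n! = (\<Sum>j=1..f. 2 * (n - j) / (j + 1))\<close>.
  At \<open>f = n\<close> this is \<open>2 * (n + 1) * H\<^sub>n - 4 * n\<close>, which also solves the Quicksort recurrence.
\<close>

section \<open>Counting unlucky cars on a partly occupied street\<close>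

primrec unlucky_from :: "nat \<Rightarrow> nat set \<Rightarrow> nat list \<Rightarrow> nat" where
  "unlucky_from n occ [] = 0"
| "unlucky_from n occ (p # ps) =
     of_bool (p \<in> occ) + unlucky_from n (occ \<union> set_option (park_spot n occ p)) ps"

lemma park_spot_free:
  assumes "p \<le> n" "p \<notin> occ"
  shows "park_spot n occ p = Some p"
proof -
  have "Min ({p..n} - occ) = p"
    using assms by (intro Min_eqI) auto
  then show ?thesis
    using assms by (auto simp: park_spot_def)
qed

lemma park_spot_eq_SomeD:
  assumes "park_spot n occ p = Some q"
  shows "q \<in> {p..n} - occ"
proof -
  have "{p..n} - occ \<noteq> {}" "q = Min ({p..n} - occ)"
    using assms by (auto simp: park_spot_def split: if_splits)
  then show ?thesis
    using Min_in[of "{p..n} - occ"] by simp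
qed

lemma park_spot_eq_None_iff: "park_spot n occ p = None \<longleftrightarrow> {p..n} \<subseteq> occ"
  by (auto simp: park_spot_def)

lemma card_less_Suc_shift:
  "card {i. i < Suc m \<and> P i} = of_bool (P 0) + card {i. i < m \<and> P (Suc i)}"
proof -
  have "{i. i < Suc m \<and> P i} = (if P 0 then {0} else {}) \<union> Suc ` {i. i < m \<and> P (Suc i)}"
    by (auto simp: image_iff less_Suc_eq_0_disj)
  then show ?thesis
    by (auto simp: card_image card_insert_if)
qed

text \<open>A car with a free preference at most \<open>n\<close> gets that spot, and no car parks
  on a taken one. So being unlucky just means preferring a taken spot, whether or not the car parks
  elsewhere.\<close>

lemma lucky_plus_unlucky_from:
  assumes "set ps \<subseteq> {1..n}"
  shows "card {i. i < length ps \<and> park_from n occ ps ! i = Some (ps ! i)} + unlucky_from n occ ps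
           = length ps"
  using assms
proof (induction ps arbitrary: occ)
  case (Cons p ps)
  have "park_spot n occ p = Some p \<longleftrightarrow> p \<notin> occ"
    using Cons.prems park_spot_free park_spot_eq_SomeD[of n occ p p] by auto
  then show ?case
    using Cons.IH[of "occ \<union> set_option (park_spot n occ p)"] Cons.prems
    by (simp add: card_less_Suc_shift)
qed simp

text \<open>Positivity of \<open>n\<close> matters: at \<open>n = 0\<close> the truncated
  \<open>n - 1\<close> equals 0, and the empty list has 0 lucky but also 0 unlucky cars.\<close>

lemma lucky_lists_count_unlucky_from:
  assumes "n > 0"
  shows "lucky_lists_count n =
           card {ps. length ps = n \<and> set ps \<subseteq> {1..n} \<and> unlucky_from n {} ps = 1}"
proof -
  have "lucky ps = n - 1 \<longleftrightarrow> unlucky_from n {} ps = 1" if "length ps = n" "set ps \<subseteq> {1..n}" for ps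
    using lucky_plus_unlucky_from[of ps n "{}"] that assms
    by (simp add: lucky_def parking_outcome_def) linarith
  then show ?thesis
    unfolding lucky_lists_count_def preference_lists_def by (intro arg_cong[of _ _ card]) auto
qed

text \<open>As long as every car is lucky, the taken spots grow by exactly the preferences read so
  far.\<close>

lemma unlucky_from_eq_0_iff:
  assumes "set ps \<subseteq> {1..n}"
  shows "unlucky_from n occ ps = 0 \<longleftrightarrow> distinct ps \<and> set ps \<inter> occ = {}"
  using assms
proof (induction ps arbitrary: occ)
  case (Cons p ps)
  then show ?case
    by (auto simp: park_spot_free)
qed simp

text \<open>Such lists are injections into the free spots. The two admissible lengths cover the cars
  that follow the unlucky one: they fill all free spots if it parked, and all but one
  otherwise.\<close>

lemma card_unlucky_from_0:
  assumes "m \<le> card ({1..n} - occ)" "card ({1..n} - occ) \<le> Suc m"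
  shows "card {ps. length ps = m \<and> set ps \<subseteq> {1..n} \<and> unlucky_from n occ ps = 0}
           = fact (card ({1..n} - occ))"
proof -
  have "{ps. length ps = m \<and> set ps \<subseteq> {1..n} \<and> unlucky_from n occ ps = 0} =
        {ps. length ps = m \<and> distinct ps \<and> set ps \<subseteq> {1..n} - occ}"
    using unlucky_from_eq_0_iff by fastforce
  also have "card \<dots> = \<Prod>{card ({1..n} - occ) - m + 1..card ({1..n} - occ)}"
    using assms by (intro card_lists_distinct_length_eq) auto
  also have "\<dots> = \<Prod>{1..card ({1..n} - occ)}"
  proof (cases "card ({1..n} - occ) = m")
    \<comment> \<open>One free spot stays empty here; the product starts at 2, so only the factor 1
      is missing.\<close>
    case False
    then have "card ({1..n} - occ) = Suc m"
      using assms by simp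
    then show ?thesis
      by (simp add: prod.atLeast_Suc_atMost)
  qed simp
  finally show ?thesis
    by (simp add: fact_prod)
qed

lemma card_lists_Suc:
  assumes "finite A"
  shows "card {ps. length ps = Suc m \<and> set ps \<subseteq> A \<and> P ps}
           = (\<Sum>p\<in>A. card {ps. length ps = m \<and> set ps \<subseteq> A \<and> P (p # ps)})"
proof -
  have fin: "finite {ps. length ps = m \<and> set ps \<subseteq> A \<and> P (p # ps)}" for p
    by (rule finite_subset[OF _ finite_lists_length_eq[OF assms, of m]]) auto
  have "{ps. length ps = Suc m \<and> set ps \<subseteq> A \<and> P ps} =
        (\<lambda>(p, ps). p # ps) ` (SIGMA p:A. {ps. length ps = m \<and> set ps \<subseteq> A \<and> P (p # ps)})"
    by (auto simp: length_Suc_conv image_iff)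
  moreover have "inj_on (\<lambda>(p, ps). p # ps) X" for X :: "('a \<times> 'a list) set"
    by (auto simp: inj_on_def)
  ultimately show ?thesis
    using assms fin by (simp add: card_image)
qed

section \<open>Recurrence for exactly one unlucky car, for a fixed set of free spots\<close>

definition one_unlucky :: "nat \<Rightarrow> nat set \<Rightarrow> nat \<Rightarrow> nat" where
  "one_unlucky n F m =
     card {ps. length ps = m \<and> set ps \<subseteq> {1..n} \<and> unlucky_from n ({1..n} - F) ps = 1}"

text \<open>A first car preferring a taken spot is the unlucky one, and all later cars must be lucky.
  If it parks, they fill the \<open>m\<close> remaining spots; otherwise they take all but one of
  \<open>Suc m\<close> free spots. Thus being unable to park contributes \<open>fact (Suc m) - fact m = m * fact m\<close>
  additional lists.\<close>

lemma one_unlucky_Suc: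
  assumes F: "F \<subseteq> {1..n}" "card F = Suc m"
  shows "one_unlucky n F (Suc m) = (\<Sum>p\<in>F. one_unlucky n (F - {p}) m)
           + (n - Suc m) * fact m + card {p \<in> {1..n}. {p..n} \<inter> F = {}} * (m * fact m)"
proof -
  define occ where "occ = {1..n} - F"
  have free: "{1..n} - occ = F"
    using F by (auto simp: occ_def)
  have occ: "occ \<subseteq> {1..n}"
    by (auto simp: occ_def)
  have fin: "finite F"
    using F(1) finite_subset by blast
  define g where
    "g = (\<lambda>p. card {ps. length ps = m \<and> set ps \<subseteq> {1..n} \<and> unlucky_from n occ (p # ps) = 1})"
  have g_free: "g p = one_unlucky n (F - {p}) m" if "p \<in> F" for p
  proof -
    have "p \<notin> occ" "p \<le> n" "insert p occ = {1..n} - (F - {p})"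
      using that F by (auto simp: occ_def)
    then show ?thesis
      by (simp add: g_def one_unlucky_def park_spot_free)
  qed
  have g_occ: "g p = fact m + of_bool ({p..n} \<inter> F = {}) * (m * fact m)" if p: "p \<in> occ" for p
  proof -
    let ?occ' = "occ \<union> set_option (park_spot n occ p)"
    have g: "g p = card {ps. length ps = m \<and> set ps \<subseteq> {1..n} \<and> unlucky_from n ?occ' ps = 0}"
      using p by (simp add: g_def)
    show ?thesis
    proof (cases "park_spot n occ p")
      case None
      then have "{p..n} \<inter> F = {}"
        by (auto simp: park_spot_eq_None_iff occ_def)
      moreover have "g p = fact (Suc m)"
        using g card_unlucky_from_0[of m n occ] F unfolding free by (simp add: None)
      ultimately show ?thesis
        by simp
    next
      case (Some q)
      have q: "q \<in> {p..n} - occ"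
        using Some by (rule park_spot_eq_SomeD)
      then have qF: "q \<in> F"
        using p by (auto simp: occ_def)
      have "{1..n} - ?occ' = F - {q}"
        using free by (auto simp: Some)
      moreover have "card (F - {q}) = m"
        using qF F fin by simp
      ultimately have "g p = fact m"
        using g card_unlucky_from_0[of m n ?occ'] by simp
      moreover have "{p..n} \<inter> F \<noteq> {}"
        using q qF by auto
      ultimately show ?thesis
        by simp
    qed
  qed
  have "one_unlucky n F (Suc m) = (\<Sum>p\<in>{1..n}. g p)"
    unfolding one_unlucky_def g_def occ_def by (rule card_lists_Suc) simp
  also have "\<dots> = (\<Sum>p\<in>F. g p) + (\<Sum>p\<in>occ. g p)"
    using F(1) fin unfolding occ_def by (subst sum.subset_diff[of F]) auto
  also have "(\<Sum>p\<in>F. g p) = (\<Sum>p\<in>F. one_unlucky n (F - {p}) m)"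
    by (intro sum.cong refl g_free)
  also have "(\<Sum>p\<in>occ. g p) = (\<Sum>p\<in>occ. fact m + of_bool ({p..n} \<inter> F = {}) * (m * fact m))"
    by (intro sum.cong refl g_occ)
  also have "\<dots> = card occ * fact m + (\<Sum>p\<in>occ. of_bool ({p..n} \<inter> F = {})) * (m * fact m)"
    by (simp add: sum.distrib sum_distrib_right)
  also have "card occ = n - Suc m"
    using F fin by (simp add: occ_def card_Diff_subset)
  also have "(\<Sum>p\<in>occ. of_bool ({p..n} \<inter> F = {})) = card {p \<in> {1..n}. {p..n} \<inter> F = {}}"
  proof -
    \<comment> \<open>If no spot in \<open>{p..n}\<close> is free, then \<open>p\<close> itself is
      taken, so letting \<open>p\<close> range over \<open>{1..n}\<close> adds nothing.\<close>
    have "{p \<in> {1..n}. {p..n} \<inter> F = {}} = occ \<inter> {p. {p..n} \<inter> F = {}}"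
      by (auto simp: occ_def)
    then show ?thesis
      by (simp add: occ_def sum_of_bool_eq)
  qed
  finally show ?thesis
    by (simp add: add.assoc)
qed

section \<open>Double counting over all sets of free spots\<close>

lemma sum_subsets_remove:
  fixes g :: "'a set \<Rightarrow> nat"
  assumes "finite A"
  shows "(\<Sum>F | F \<subseteq> A \<and> card F = Suc m. \<Sum>p\<in>F. g (F - {p}))
           = (card A - m) * (\<Sum>F | F \<subseteq> A \<and> card F = m. g F)"
proof -
  have fin: "finite F" if "F \<subseteq> A" for F
    using that assms finite_subset by blast
  have "(\<Sum>F | F \<subseteq> A \<and> card F = Suc m. \<Sum>p\<in>F. g (F - {p}))
      = (\<Sum>(F, p) \<in> (SIGMA F:{F. F \<subseteq> A \<and> card F = Suc m}. F). g (F - {p}))"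
    using assms fin by (subst sum.Sigma) auto
  \<comment> \<open>Moving \<open>p\<close> out of \<open>F\<close> is a bijection; afterwards
    \<open>F\<close> has \<open>m\<close> elements and \<open>p\<close> is any of the
    \<open>card A - m\<close> elements outside it.\<close>
  also have "\<dots> = (\<Sum>(F, p) \<in> (SIGMA F:{F. F \<subseteq> A \<and> card F = m}. A - F). g F)"
    using fin by (intro sum.reindex_bij_witness[of _ "\<lambda>(F, p). (insert p F, p)" "\<lambda>(F, p). (F - {p}, p)"])
      (auto simp: insert_absorb card_insert_if)
  also have "\<dots> = (\<Sum>F | F \<subseteq> A \<and> card F = m. \<Sum>p\<in>A - F. g F)"
    using assms by (subst sum.Sigma) auto
  also have "\<dots> = (\<Sum>F | F \<subseteq> A \<and> card F = m. (card A - m) * g F)"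
    using assms fin by (intro sum.cong) (auto simp: card_Diff_subset)
  finally show ?thesis
    by (simp add: sum_distrib_left)
qed

text \<open>The hockey-stick identity; it sums the counts for all starting points \<open>p\<close>
  in the next lemma.\<close>

lemma sum_choose_lessThan: "(\<Sum>i<n. i choose k) = n choose Suc k"
  by (induction n) simp_all

text \<open>After exchanging the sums, a fixed \<open>p\<close> admits exactly the
  \<open>k\<close>-subsets of \<open>{1..p - 1}\<close>.\<close>

lemma sum_card_final_segments:
  "(\<Sum>F | F \<subseteq> {1..n} \<and> card F = k. card {p \<in> {1..n}. {p..n} \<inter> F = {}}) = n choose Suc k"
proof -
  have "(\<Sum>F | F \<subseteq> {1..n} \<and> card F = k. card {p \<in> {1..n}. {p..n} \<inter> F = {}})
      = (\<Sum>F | F \<subseteq> {1..n} \<and> card F = k. \<Sum>p\<in>{1..n}. of_bool ({p..n} \<inter> F = {}))"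
    by (simp add: sum_of_bool_eq Int_def)
  also have "\<dots> = (\<Sum>p\<in>{1..n}. \<Sum>F | F \<subseteq> {1..n} \<and> card F = k. of_bool ({p..n} \<inter> F = {}))"
    by (rule sum.swap)
  also have "\<dots> = (\<Sum>p\<in>{1..n}. (p - 1) choose k)"
  proof (rule sum.cong)
    fix p assume p: "p \<in> {1..n}"
    have eq: "{F. F \<subseteq> {1..n} \<and> card F = k} \<inter> {F. {p..n} \<inter> F = {}} = {F. F \<subseteq> {1..p - 1} \<and> card F = k}"
      (is "?L = ?R")
    proof
      show "?L \<subseteq> ?R"
      proof
        fix F assume F: "F \<in> ?L"
        have "x \<in> {1..p - 1}" if "x \<in> F" for x
        proof -
          have "x \<in> {1..n}" "x \<notin> {p..n}" using F that by auto
          then show ?thesis by auto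
        qed
        then show "F \<in> ?R" using F by auto
      qed
      show "?R \<subseteq> ?L"
      proof
        fix F assume F: "F \<in> ?R"
        have "x \<in> {1..n} \<and> x \<notin> {p..n}" if "x \<in> F" for x
        proof -
          have "x \<in> {1..p - 1}" using F that by blast
          then show ?thesis using p by auto
        qed
        then show "F \<in> ?L" using F by blast
      qed
    qed
    have "finite {F. F \<subseteq> {1..n} \<and> card F = k}"
      by (rule finite_subset[of _ "Pow {1..n}"]) auto
    then show "(\<Sum>F | F \<subseteq> {1..n} \<and> card F = k. of_bool ({p..n} \<inter> F = {})) = (p - 1) choose k"
      using n_subsets[of "{1..p - 1}" k] eq by (simp add: sum_of_bool_eq)
  qed simp
  also have "\<dots> = (\<Sum>i<n. i choose k)"
    by (rule sum.reindex_bij_witness[of _ Suc "\<lambda>p. p - 1"]) auto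
  finally show ?thesis
    by (simp add: sum_choose_lessThan)
qed

section \<open>The summed recurrence and its closed form\<close>

definition total_one_unlucky :: "nat \<Rightarrow> nat \<Rightarrow> nat" where
  "total_one_unlucky n f = (\<Sum>F | F \<subseteq> {1..n} \<and> card F = f. one_unlucky n F f)"

lemma total_one_unlucky_0: "total_one_unlucky n 0 = 0"
  by (auto simp: total_one_unlucky_def one_unlucky_def intro!: sum.neutral)

lemma total_one_unlucky_self:
  assumes "n > 0"
  shows "total_one_unlucky n n = lucky_lists_count n"
proof -
  have "{F. F \<subseteq> {1..n} \<and> card F = n} = {{1..n}}"
    using card_subset_eq[OF finite_atLeastAtMost, of _ 1 n] by (intro equalityI subsetI) simp_all
  then show ?thesis
    using assms by (simp add: total_one_unlucky_def one_unlucky_def lucky_lists_count_unlucky_from)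
qed

text \<open>Summing \<open>one_unlucky_Suc\<close> over all \<open>F\<close> of size
  \<open>Suc m\<close>: the only term depending on the shape of \<open>F\<close>, apart from the
  recursive one, becomes a binomial coefficient.\<close>

lemma total_one_unlucky_Suc:
  "total_one_unlucky n (Suc m) = (n - m) * total_one_unlucky n m
     + (n choose Suc m) * ((n - Suc m) * fact m) + (n choose Suc (Suc m)) * (m * fact m)"
proof -
  let ?S = "{F. F \<subseteq> {1..n} \<and> card F = Suc m}"
  have "total_one_unlucky n (Suc m) = (\<Sum>F\<in>?S. (\<Sum>p\<in>F. one_unlucky n (F - {p}) m)
          + (n - Suc m) * fact m + card {p \<in> {1..n}. {p..n} \<inter> F = {}} * (m * fact m))"
    unfolding total_one_unlucky_def by (intro sum.cong refl one_unlucky_Suc) auto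
  also have "\<dots> = (\<Sum>F\<in>?S. \<Sum>p\<in>F. one_unlucky n (F - {p}) m) + card ?S * ((n - Suc m) * fact m)
      + (\<Sum>F\<in>?S. card {p \<in> {1..n}. {p..n} \<inter> F = {}}) * (m * fact m)"
    unfolding sum.distrib sum_distrib_right[symmetric] sum_constant by simp
  also have "(\<Sum>F\<in>?S. \<Sum>p\<in>F. one_unlucky n (F - {p}) m) = (n - m) * total_one_unlucky n m"
    using sum_subsets_remove[of "{1..n}" "\<lambda>F. one_unlucky n F m" m]
    unfolding total_one_unlucky_def card_atLeastAtMost by simp
  also have "card ?S = n choose Suc m"
    using n_subsets[of "{1..n}" "Suc m"] by simp
  finally show ?thesis
    unfolding sum_card_final_segments .
qed

text \<open>The factor \<open>fact (n - f)\<close> absorbs the coefficient \<open>n - m\<close> of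
  the recurrence, so each step merely adds a summand.\<close>

lemma total_one_unlucky_closed:
  assumes "f \<le> n"
  shows "real (total_one_unlucky n f) * fact (n - f)
           = fact n * (\<Sum>j=1..f. 2 * (real n - real j) / (real j + 1))"
  using assms
proof (induction f)
  case (Suc m)
  define d where "d = n - Suc m"
  have n: "n = Suc (m + d)"
    using Suc.prems by (simp add: d_def)
  have b1: "real (n choose Suc m) * (fact m * fact d) = fact n / (real m + 1)"
  proof -
    have "real (n choose Suc m) = fact n / (fact (Suc m) * fact d)"
      using binomial_fact[of "Suc m" n, where 'a = real] Suc.prems by (simp only: d_def)
    moreover have "fact (Suc m) = (real m + 1) * fact m"
      by (simp add: algebra_simps)
    ultimately show ?thesis
      by simp
  qed
  have b2: "real (n choose Suc (Suc m)) * (fact m * fact d)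
              = fact n * real d / ((real m + 1) * (real m + 2))"
  proof (cases d)
    \<comment> \<open>The street becomes completely free, and the binomial coefficient vanishes like
      the right-hand side; the factorial formula applies only for \<open>d > 0\<close>.\<close>
    case 0
    then show ?thesis
      by (simp add: n binomial_eq_0)
  next
    case (Suc e)
    have "real (n choose Suc (Suc m)) = fact n / (fact (Suc (Suc m)) * fact e)"
      using binomial_fact[of "Suc (Suc m)" n, where 'a = real] n Suc by simp
    moreover have "fact (Suc (Suc m)) = (real m + 2) * ((real m + 1) * fact m)"
      by (simp add: algebra_simps)
    moreover have "fact d = (real e + 1) * fact e"
      by (simp add: Suc algebra_simps)
    ultimately show ?thesis
      by (simp add: Suc)
  qed
  have "real (total_one_unlucky n (Suc m)) * fact d
      = real (total_one_unlucky n m) * ((real d + 1) * fact d)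
        + real (n choose Suc m) * (fact m * fact d) * real d
        + real (n choose Suc (Suc m)) * (fact m * fact d) * real m"
  proof -
    have "n - m = Suc d"
      by (simp add: n)
    then show ?thesis
      unfolding total_one_unlucky_Suc d_def[symmetric] by (simp add: algebra_simps del: fact_Suc)
  qed
  also have "(real d + 1) * fact d = fact (n - m)"
    by (simp add: n algebra_simps)
  also have "real (total_one_unlucky n m) * fact (n - m)
      = fact n * (\<Sum>j=1..m. 2 * (real n - real j) / (real j + 1))"
    using Suc.IH Suc.prems by simp
  also have "\<dots> + real (n choose Suc m) * (fact m * fact d) * real d
        + real (n choose Suc (Suc m)) * (fact m * fact d) * real m
      = fact n * ((\<Sum>j=1..m. 2 * (real n - real j) / (real j + 1)) + 2 * real d / (real m + 2))"
    unfolding b1 b2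
  proof -
    \<comment> \<open>Both inhomogeneous terms merge because
      \<open>1 + m / (m + 2) = 2 * (m + 1) / (m + 2)\<close>.\<close>
    have "real d / (real m + 1) + real d * real m / ((real m + 1) * (real m + 2))
        = 2 * real d / (real m + 2)"
      by (simp add: divide_simps) (simp add: algebra_simps)
    then have "fact n * (real d / (real m + 1) + real d * real m / ((real m + 1) * (real m + 2)))
        = fact n * (2 * real d / (real m + 2))"
      by simp
    then show "fact n * (\<Sum>j=1..m. 2 * (real n - real j) / (real j + 1))
          + fact n / (real m + 1) * real d
          + fact n * real d / ((real m + 1) * (real m + 2)) * real m
        = fact n * ((\<Sum>j=1..m. 2 * (real n - real j) / (real j + 1)) + 2 * real d / (real m + 2))"
      by (simp add: distrib_left mult.assoc)
  qed
  also have "2 * real d / (real m + 2) = 2 * (real n - real (Suc m)) / (real (Suc m) + 1)"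
    by (simp add: n)
  finally show ?case
    by (simp add: d_def)
qed (simp add: total_one_unlucky_0)

text \<open>Rests on \<open>(x - j) / (j + 1) = (x + 1) / (j + 1) - 1\<close>. Keeping
  \<open>x\<close> apart from \<open>f\<close> lets the induction on \<open>f\<close> go through;
  later both are \<open>n\<close>.\<close>

lemma sum_lucky_harm:
  "(\<Sum>j=1..f. 2 * (x - real j) / (real j + 1)) = 2 * (x + 1) * (harm (Suc f) - 1) - 2 * real f"
proof (induction f)
  case 0
  then show ?case
    by (simp add: harm_def)
next
  case (Suc f)
  have "(\<Sum>j=1..Suc f. 2 * (x - real j) / (real j + 1))
      = 2 * (x + 1) * (harm (Suc f) - 1) - 2 * real f + 2 * (x - real (Suc f)) / (real (Suc f) + 1)"
    using Suc.IH by simp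
  also have "2 * (x - real (Suc f)) / (real (Suc f) + 1) = 2 * (x + 1) * (1 / (real f + 2)) - 2"
    by (simp add: field_simps)
  also have "1 / (real f + 2) = harm (Suc (Suc f)) - harm (Suc f)"
    by (simp add: harm_Suc[of "Suc f"] inverse_eq_divide add.commute)
  finally show ?case
    by (simp add: algebra_simps)
qed

lemma lucky_lists_count_closed:
  assumes "n > 0"
  shows "real (lucky_lists_count n) = fact n * (2 * (real n + 1) * harm n - 4 * real n)"
proof -
  have "real (lucky_lists_count n) = fact n * (2 * (real n + 1) * (harm (Suc n) - 1) - 2 * real n)"
    using total_one_unlucky_closed[of n n] total_one_unlucky_self[OF assms]
    unfolding sum_lucky_harm by simp
  also have "2 * (real n + 1) * (harm (Suc n) - 1) - 2 * real n
      = 2 * (real n + 1) * harm n - 4 * real n"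
    by (simp add: harm_Suc field_simps)
  finally show ?thesis .
qed

section \<open>Expected cost of Quicksort\<close>

lemma sum_card_less:
  fixes A :: "'a :: linorder set" and f :: "nat \<Rightarrow> 'b :: comm_monoid_add"
  assumes "finite A"
  shows "(\<Sum>x\<in>A. f (card {y \<in> A. y < x})) = (\<Sum>k<card A. f k)"
  using assms
proof (induction A rule: finite_linorder_max_induct)
  case (insert b A)
  \<comment> \<open>The new maximum \<open>b\<close> has rank \<open>card A\<close>, the one new
    index on the right, and all other ranks are unchanged.\<close>
  have "{y \<in> insert b A. y < b} = A"
    using insert.hyps by auto
  moreover have "{y \<in> insert b A. y < x} = {y \<in> A. y < x}" if "x \<in> A" for x
    using insert.hyps(2) that by force
  moreover have "b \<notin> A"
    using insert.hyps by auto
  ultimately show ?case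
    using insert by (simp add: add.commute)
qed simp

lemma sum_card_greater:
  fixes A :: "'a :: linorder set" and f :: "nat \<Rightarrow> 'b :: comm_monoid_add"
  assumes "finite A"
  shows "(\<Sum>x\<in>A. f (card {y \<in> A. y > x})) = (\<Sum>k<card A. f k)"
  using assms
proof (induction A rule: finite_linorder_min_induct)
  case (insert b A)
  have "{y \<in> insert b A. y > b} = A"
    using insert.hyps by auto
  moreover have "{y \<in> insert b A. y > x} = {y \<in> A. y > x}" if "x \<in> A" for x
    using insert.hyps(2) that by force
  moreover have "b \<notin> A"
    using insert.hyps by auto
  ultimately show ?case
    using insert by (simp add: add.commute)
qed simp

text \<open>Partitioning a uniformly random permutation yields uniform permutations of both parts;
  this is why the recursive calls again see random input.\<close>

lemma filter_random_permutation:
  assumes "finite A"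
  shows "map_pmf (filter P) (pmf_of_set (permutations_of_set A))
           = pmf_of_set (permutations_of_set {x \<in> A. P x})"
proof -
  have "map_pmf (filter P) (pmf_of_set (permutations_of_set A))
      = map_pmf fst (map_pmf (partition P) (pmf_of_set (permutations_of_set A)))"
    by (simp add: pmf.map_comp o_def)
  then show ?thesis
    using assms by (simp add: partition_random_permutations map_fst_pair_pmf)
qed

text \<open>Stated for arbitrary finite sets because the subarrays are not of the form
  \<open>{1..k}\<close>.\<close>

abbreviation expected_comparisons_on :: "'a :: linorder set \<Rightarrow> real" where
  "expected_comparisons_on A \<equiv>
     measure_pmf.expectation (pmf_of_set (permutations_of_set A)) (\<lambda>xs. real (quicksort_comparisons xs))"

lemma expected_comparisons_filter:
  fixes A :: "'a :: linorder set"
  assumes "finite A"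
  shows "measure_pmf.expectation (pmf_of_set (permutations_of_set A))
             (\<lambda>xs. real (quicksort_comparisons (filter P xs)))
           = expected_comparisons_on {x \<in> A. P x}"
  unfolding filter_random_permutation[OF assms, symmetric] by simp

text \<open>Conditioning on the pivot, then linearity of expectation; multiplying by
  \<open>card A\<close> clears the division in the uniform average.\<close>

lemma expected_comparisons_on_rec:
  fixes A :: "'a :: linorder set"
  assumes "finite A" "A \<noteq> {}"
  shows "card A * expected_comparisons_on A = card A * (card A - 1)
           + (\<Sum>x\<in>A. expected_comparisons_on {y \<in> A. y < x} + expected_comparisons_on {y \<in> A. y > x})"
proof -
  have step: "measure_pmf.expectation (pmf_of_set (permutations_of_set (A - {x})))
                (\<lambda>xs. real (quicksort_comparisons (x # xs)))
      = (card A - 1) + (expected_comparisons_on {y \<in> A. y < x} + expected_comparisons_on {y \<in> A. y > x})"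
    (is "measure_pmf.expectation ?p _ = _") if "x \<in> A" for x
  proof -
    have fin: "finite (A - {x})"
      using assms by simp
    have supp: "set_pmf ?p = permutations_of_set (A - {x})"
      using fin by (subst set_pmf_of_set) auto
    have int: "integrable (measure_pmf ?p) f" for f :: "'a list \<Rightarrow> real"
      using fin by (intro integrable_measure_pmf_finite) (simp add: supp)
    have "measure_pmf.expectation ?p (\<lambda>xs. real (quicksort_comparisons (x # xs)))
        = measure_pmf.expectation ?p (\<lambda>xs. real (card A - 1)
            + (real (quicksort_comparisons (filter (\<lambda>y. y \<le> x) xs))
               + real (quicksort_comparisons (filter (\<lambda>y. y > x) xs))))"
    \<comment> \<open>Equality is needed only on the support, where the length of \<open>xs\<close>
      is known.\<close>
    proof (intro integral_cong_AE AE_pmfI)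
      fix xs assume "xs \<in> set_pmf ?p"
      then have "length xs = card A - 1"
        using that assms by (simp add: supp length_finite_permutations_of_set)
      then show "real (quicksort_comparisons (x # xs)) = real (card A - 1)
            + (real (quicksort_comparisons (filter (\<lambda>y. y \<le> x) xs))
               + real (quicksort_comparisons (filter (\<lambda>y. y > x) xs)))"
        by simp
    qed simp_all
    also have "\<dots> = (card A - 1) + (expected_comparisons_on {y \<in> A - {x}. y \<le> x}
                                  + expected_comparisons_on {y \<in> A - {x}. y > x})"
      using expected_comparisons_filter[OF fin, of "\<lambda>y. y \<le> x"]
        expected_comparisons_filter[OF fin, of "\<lambda>y. y > x"]
      by (simp add: int)
    also have "{y \<in> A - {x}. y \<le> x} = {y \<in> A. y < x}"
      by auto
    also have "{y \<in> A - {x}. y > x} = {y \<in> A. y > x}"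
      by auto
    finally show ?thesis .
  qed
  \<comment> \<open>A random permutation is a uniform first element followed by a random permutation
    of the rest.\<close>
  have "pmf_of_set (permutations_of_set A)
      = pmf_of_set A \<bind> (\<lambda>x. map_pmf ((#) x) (pmf_of_set (permutations_of_set (A - {x}))))"
    using assms by (simp add: random_permutation_of_set map_pmf_def)
  then have "expected_comparisons_on A
      = (\<Sum>x\<in>A. measure_pmf.expectation (pmf_of_set (permutations_of_set (A - {x})))
                (\<lambda>xs. real (quicksort_comparisons (x # xs))) / card A)"
    using assms by (simp only:, subst pmf_expectation_bind_pmf_of_set) (auto simp: divide_inverse_commute)
  also have "\<dots> = (\<Sum>x\<in>A. (card A - 1) + (expected_comparisons_on {y \<in> A. y < x}
                     + expected_comparisons_on {y \<in> A. y > x})) / card A"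
    unfolding sum_divide_distrib[symmetric]
    by (intro arg_cong2[of _ _ _ _ "(/)"] sum.cong refl step)
  finally show ?thesis
    using assms by (simp add: sum.distrib)
qed

text \<open>The Quicksort recurrence multiplied by \<open>n\<close>; the factor 2 merges the equal
  sums for left and right subarrays.\<close>

lemma quicksort_recurrence:
  "real n * (real n - 1) + 2 * (\<Sum>k<n. 2 * (real k + 1) * harm k - 4 * real k)
     = n * (2 * (real n + 1) * harm n - 4 * real n)"
proof (induction n)
  case (Suc n)
  \<comment> \<open>The factor \<open>n + 1\<close> cancels the denominator of the last harmonic
    term, leaving a polynomial identity once \<open>harm n\<close> is treated as a variable.\<close>
  have h: "(real n + 1) * harm (Suc n) = (real n + 1) * harm n + 1"
    by (simp add: harm_Suc field_simps)
  have "real (Suc n) * (2 * (real (Suc n) + 1) * harm (Suc n) - 4 * real (Suc n))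
      = 2 * (real n + 2) * ((real n + 1) * harm (Suc n)) - 4 * (real n + 1)^2"
    by (simp add: algebra_simps power2_eq_square)
  then show ?case
    using Suc.IH unfolding h by (simp add: algebra_simps power2_eq_square)
qed simp

lemma expected_comparisons_on_closed:
  fixes A :: "'a :: linorder set"
  assumes "finite A"
  shows "expected_comparisons_on A = 2 * (real (card A) + 1) * harm (card A) - 4 * real (card A)"
  using assms
proof (induction A rule: finite_psubset_induct)
  case (psubset A)
  define Q where "Q = (\<lambda>k. 2 * (real k + 1) * harm k - 4 * real k)"
  show ?case
  proof (cases "A = {}")
    case True
    then show ?thesis
      by (simp add: pmf_of_set_singleton harm_def)
  next
    case False
    \<comment> \<open>Both subarrays omit the pivot, so they are proper subsets and the induction
      hypothesis gives values depending only on their sizes.\<close>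
    have "card A * expected_comparisons_on A = real (card A * (card A - 1))
        + (\<Sum>x\<in>A. Q (card {y \<in> A. y < x}) + Q (card {y \<in> A. y > x}))"
      unfolding expected_comparisons_on_rec[OF psubset.hyps False] Q_def
      by (intro arg_cong2[of _ _ _ _ "(+)"] sum.cong refl psubset.IH) auto
    also have "\<dots> = real (card A) * (real (card A) - 1) + 2 * (\<Sum>k<card A. Q k)"
      using psubset.hyps False
      by (simp add: sum.distrib sum_card_less sum_card_greater of_nat_diff Suc_leI card_gt_0_iff)
    also have "\<dots> = card A * Q (card A)"
      unfolding Q_def by (rule quicksort_recurrence)
    finally show ?thesis
      using psubset.hyps False by (simp add: Q_def)
  qed
qed

section \<open>Equality of the two counts\<close>

lemma total_comparisons_eq: "real (total_comparisons n) = fact n * expected_comparisons n"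
  unfolding expected_comparisons_def total_comparisons_def
  by (subst integral_pmf_of_set) auto

theorem theorem1:
  fixes n :: nat
  assumes "n \<ge> 2"
  shows "lucky_lists_count n = total_comparisons n
       \<and> real (total_comparisons n) = fact n * expected_comparisons n
       \<and> expected_comparisons n = 2 * (real n + 1) * harm n - 4 * real n
       \<and> real (lucky_lists_count n) = fact n * (2 * (real n + 1) * harm n - 4 * real n)"
proof -
  have E: "expected_comparisons n = 2 * (real n + 1) * harm n - 4 * real n"
    using expected_comparisons_on_closed[of "{1..n}"] by (simp add: expected_comparisons_def)
  have L: "real (lucky_lists_count n) = fact n * (2 * (real n + 1) * harm n - 4 * real n)"
    using assms by (intro lucky_lists_count_closed) simp
  have "real (lucky_lists_count n) = real (total_comparisons n)"
    unfolding total_comparisons_eq E L ..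
  then show ?thesis
    using total_comparisons_eq[of n] E L unfolding of_nat_eq_iff by blast
qed

end
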